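(* Let $n$ be a positive integer. For $\mathfrak g$ of type $A_2^{(2)}$ at level $2n$, the product structure of the Verlinde algebra $V_{2n}(\mathfrak g)$ is explicitly given, for integers $0\le b\le a\le n$, by $$\chi_{a\Lambda}\otimes\chi_{b\Lambda}=\sum_{0\le i\le\min\left(b,\frac{n+b-a}{2}\right)}\chi_{(a-b+2i)\Lambda}-\sum_{\frac{n+b-a}{2}<i\le b}\chi_{(2n+1+b-2i-a)\Lambda},$$ where $i$ runs over integers.
   Context: For $\mathfrak g$ of type $A_2^{(2)}$ (dual Coxeter number $h^\vee=3$), the underlying simple Lie algebra is $\mathfrak{sl}_2$ with simple root $\alpha$ and fundamental weight $\Lambda=\overline\Lambda_1=\alpha/2$, and $(\Lambda,\Lambda)=1$ in the normalized form of $\mathfrak g$. The dominant integral weights of level $2n$ (modulo $\mathbb C\delta$) have finite parts $m\Lambda$, $0\le m\le n$; $\chi_{m\Lambda}$ denotes the corresponding normalized character. The Verlinde algebra $V_{2n}(\mathfrak g)$ is the complex vector space with basis $\chi_{0},\chi_\Lambda,\dots,\chi_{n\Lambda}$ and product (denoted $\otimes$) $\chi_{a\Lambda}\otimes\chi_{b\Lambda}=\sum_{c=0}^nN_{ab}^c\chi_{c\Lambda}$, with structure constants given by the Verlinde formula $$N_{ab}^c=\sum_{d=0}^n\frac{S_{ad}S_{bd}(S^{-1})_{cd}}{S_{0d}},$$ where $S$ is the matrix of the modular transformation $S=\begin{pmatrix}0&-1\\1&0\end{pmatrix}$ on the level $2n$ characters: $$S_{ab}=\frac{2}{\sqrt{2n+3}}\sin\frac{2\pi(a+1)(b+1)}{2n+3},\qquad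 0\le a,b\le n.$$ *)

theory Defs
  imports Complex_Main Jordan_Normal_Form.Gauss_Jordan_Elimination
begin

text \<open>
  Throughout, \<open>n\<close> stands for the level \<open>2n\<close> of the affine Lie algebra of type \<open>A\<^sub>2\<^sup>(\<^sup>2\<^sup>)\<close>, whose dominant
  integral weights have finite parts \<open>m \<Lambda>\<close> with \<open>0 \<le> m \<le> n\<close>; such a weight is represented by the
  natural number \<open>m\<close>.
\<close>

definition verlinde_S :: "nat \<Rightarrow> complex mat" where
  "verlinde_S n = mat (n + 1) (n + 1) (\<lambda>(a, b).
     complex_of_real (2 / sqrt (2 * real n + 3) *
       sin (2 * pi * (real a + 1) * (real b + 1) / (2 * real n + 3))))"

text \<open>The matrix above is nonsingular, so that \<^const>\<open>mat_inverse\<close> yields an actual inverse.\<close>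

definition verlinde_S_inv :: "nat \<Rightarrow> complex mat" where
  "verlinde_S_inv n = the (mat_inverse (verlinde_S n))"

text \<open>\<open>verlinde_N n a b c\<close> is the structure constant \<open>N\<^sub>a\<^sub>b\<^sup>c\<close>.\<close>

definition verlinde_N :: "nat \<Rightarrow> nat \<Rightarrow> nat \<Rightarrow> nat \<Rightarrow> complex" where
  "verlinde_N n a b c =
     (\<Sum>d = 0..n. verlinde_S n $$ (a, d) * verlinde_S n $$ (b, d) * verlinde_S_inv n $$ (c, d)
                   / verlinde_S n $$ (0, d))"

text \<open>
  Only indices \<open>m \<le> n\<close> are meaningful: \<open>verlinde_chi n 0, \<dots>, verlinde_chi n n\<close> is the standard
  basis of the space of complex vectors of dimension \<open>n + 1\<close>.
\<close>

definition verlinde_chi :: "nat \<Rightarrow> nat \<Rightarrow> complex vec" where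
  "verlinde_chi n m = unit_vec (n + 1) m"

text \<open>
  The product is the bilinear extension of \<open>\<chi>\<^sub>a \<otimes> \<chi>\<^sub>b = \<Sum>\<^sub>c N\<^sub>a\<^sub>b\<^sup>c \<chi>\<^sub>c\<close>.
  The record type also asks for a unit, which is \<open>\<chi>\<^sub>0\<close> because \<open>N\<^sub>a\<^sub>0\<^sup>c\<close> is the Kronecker delta.
\<close>

definition verlinde_algebra :: "nat \<Rightarrow> (complex, complex vec) module" where
  "verlinde_algebra n = (module_vec TYPE(complex) (n + 1))
     \<lparr> mult := (\<lambda>v w. vec (n + 1) (\<lambda>c. \<Sum>a = 0..n. \<Sum>b = 0..n. v $ a * w $ b * verlinde_N n a b c)),
       one := verlinde_chi n 0 \<rparr>"

end

theory Submission
  imports Defs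
begin

text \<open>
  Orthogonality of the sines at the odd modulus \<open>2 n + 3\<close> makes the symmetric matrix \<open>S\<close> an
  involution, so \<open>S\<close> replaces its inverse in the Verlinde formula. The quotient
  \<open>S\<^sub>a\<^sub>d S\<^sub>b\<^sub>d / S\<^sub>0\<^sub>d\<close> expands by the Clebsch-Gordan identity for \<open>sl\<^sub>2\<close> into the sum of
  \<open>S\<^sub>m\<^sub>d\<close> over \<open>m = a - b, a - b + 2, \<dots>, a + b\<close>. Indices \<open>m > n\<close> are reflected to
  \<open>2 n + 1 - m\<close> at the cost of a sign, after which orthogonality reads off the coefficients.
\<close>

section \<open>Trigonometric sums at an odd modulus\<close>

text \<open>Multiplying by \<open>2 * sin y\<close>, where \<open>2 * y\<close> is the angle step,
  makes the sum telescope to sin (m pi) - sin y = - sin y. The bounds on \<open>m\<close> put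
  \<open>y\<close> strictly between 0 and pi, so sin y can be cancelled.\<close>

lemma sum_cos_odd_roots:
  fixes m N :: nat
  assumes "0 < m" "m < 2 * N + 1"
  shows "(\<Sum>d = 1..N. cos (2 * pi * real m * real d / (2 * real N + 1))) = - 1 / 2"
proof -
  define y where "y = pi * real m / (2 * real N + 1)"
  define f where "f d = sin ((2 * real d + 1) * y)" for d :: nat
  have "real m < 2 * real N + 1" using assms by linarith
  then have "0 < y" "y < pi"
    using assms by (simp_all add: y_def divide_simps)
  then have s: "sin y > 0" by (rule sin_gt_zero)
  have step: "f (Suc d) - f d = 2 * sin y * cos (2 * pi * real m * real (Suc d) / (2 * real N + 1))" for d
  proof -
    have e: "2 * pi * real m * real (Suc d) / (2 * real N + 1) = 2 * real (Suc d) * y"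
      by (simp add: y_def)
    have "f (Suc d) = sin (2 * real (Suc d) * y + y)" "f d = sin (2 * real (Suc d) * y - y)"
      by (simp_all add: f_def algebra_simps)
    then show ?thesis
      unfolding e by (simp only: sin_add sin_diff) (simp add: algebra_simps)
  qed
  have "2 * sin y * (\<Sum>d = 1..N. cos (2 * pi * real m * real d / (2 * real N + 1)))
      = (\<Sum>d<N. 2 * sin y * cos (2 * pi * real m * real (Suc d) / (2 * real N + 1)))"
    by (simp only: sum_distrib_left One_nat_def sum.atLeast1_atMost_eq)
  also have "\<dots> = (\<Sum>d<N. f (Suc d) - f d)"
    by (simp only: step)
  also have "\<dots> = f N - f 0" by (rule sum_lessThan_telescope)
  also have "f N = sin (real m * pi)"
  proof -
    have "(2 * real N + 1) * y = real m * pi" by (simp add: y_def divide_simps add_eq_0_iff)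
    then show ?thesis by (simp add: f_def)
  qed
  finally have "sin y * (2 * (\<Sum>d = 1..N. cos (2 * pi * real m * real d / (2 * real N + 1)))) = sin y * (- 1)"
    by (simp add: f_def mult.commute mult.left_commute)
  with s have "2 * (\<Sum>d = 1..N. cos (2 * pi * real m * real d / (2 * real N + 1))) = - 1"
    by (metis mult_left_cancel less_irrefl)
  then show ?thesis by linarith
qed

text \<open>A product of sines is half the difference of cosines at the frequencies j - k and j + k.
  Nonzero frequencies sum to -1/2 each and cancel; for j = k the first sum is N, which leaves (N +
  1/2) / 2.\<close>

lemma sum_sin_orthogonal:
  fixes j k N :: nat
  assumes "0 < j" "j \<le> N" "0 < k" "k \<le> N"
  shows "(\<Sum>d = 1..N. sin (2 * pi * real j * real d / (2 * real N + 1)) *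
            sin (2 * pi * real k * real d / (2 * real N + 1)))
       = (if j = k then (2 * real N + 1) / 4 else 0)"
    (is "?lhs = _")
proof -
  \<comment> \<open>The frequency is a real number because j - k may be negative; evenness of the
    cosine then reduces the case j < k to k - j.\<close>
  define C where "C m = (\<Sum>d = 1..N. cos (2 * pi * m * real d / (2 * real N + 1)))" for m :: real
  have split: "sin (2 * pi * real j * real d / (2 * real N + 1)) *
            sin (2 * pi * real k * real d / (2 * real N + 1))
     = (cos (2 * pi * (real j - real k) * real d / (2 * real N + 1))
        - cos (2 * pi * (real j + real k) * real d / (2 * real N + 1))) / 2" for d
    by (simp add: sin_times_sin ring_distribs add_divide_distrib diff_divide_distrib)
  have "?lhs = (C (real j - real k) - C (real j + real k)) / 2"
    unfolding split C_def by (simp add: sum_subtractf sum_divide_distrib[symmetric])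
  \<comment> \<open>Here 0 < j + k <= 2 N < 2 N + 1.\<close>
  moreover have "C (real j + real k) = - 1 / 2"
    unfolding C_def using sum_cos_odd_roots[of "j + k" N] assms by simp
  moreover have "C (real j - real k) = (if j = k then real N else - 1 / 2)"
  proof (cases j k rule: linorder_cases)
    case less
    have "C (real j - real k) = C (real (k - j))"
      unfolding C_def
    proof (rule sum.cong)
      fix d assume "d \<in> {1..N}"
      have "2 * pi * (real j - real k) * real d = - (2 * pi * real (k - j) * real d)"
        using less by (simp add: of_nat_diff algebra_simps)
      then have "2 * pi * (real j - real k) * real d / (2 * real N + 1)
          = - (2 * pi * real (k - j) * real d / (2 * real N + 1))"
        by (simp only: minus_divide_left)
      then show "cos (2 * pi * (real j - real k) * real d / (2 * real N + 1))
          = cos (2 * pi * real (k - j) * real d / (2 * real N + 1))"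
        by (simp only: cos_minus)
    qed simp
    also have "\<dots> = - 1 / 2"
      unfolding C_def using less assms by (intro sum_cos_odd_roots) auto
    finally show ?thesis using less by simp
  next
    case equal
    then show ?thesis by (simp add: C_def)
  next
    case greater
    then have "C (real j - real k) = C (real (j - k))" by (simp add: of_nat_diff)
    also have "\<dots> = - 1 / 2"
      unfolding C_def using greater assms by (intro sum_cos_odd_roots) auto
    finally show ?thesis using greater by simp
  qed
  ultimately have "?lhs = ((if j = k then real N else - 1 / 2) - (- 1 / 2)) / 2"
    by (simp only:)
  also have "\<dots> = (if j = k then (2 * real N + 1) / 4 else 0)"
    by (simp add: field_simps)
  finally show ?thesis .
qed

section \<open>The matrix S is its own inverse\<close>

lemma verlinde_S_carrier [simp]: "verlinde_S n \<in> carrier_mat (Suc n) (Suc n)"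
  by (simp add: verlinde_S_def)

lemma verlinde_S_index:
  assumes "a \<le> n" "d \<le> n"
  shows "verlinde_S n $$ (a, d) = complex_of_real (2 / sqrt (2 * real n + 3) *
     sin (2 * pi * (real a + 1) * (real d + 1) / (2 * real n + 3)))"
  using assms by (simp add: verlinde_S_def)

lemma verlinde_S_orthogonal:
  assumes "a \<le> n" "c \<le> n"
  shows "(\<Sum>d = 0..n. verlinde_S n $$ (a, d) * verlinde_S n $$ (c, d)) = (if a = c then 1 else 0)"
proof -
  define s where "s j d = sin (2 * pi * (real j + 1) * (real d + 1) / (2 * real n + 3))" for j d :: nat
  \<comment> \<open>Shifting the weights by one matches the sine sums at N = n + 1, whose modulus 2
    N + 1 is 2 n + 3.\<close>
  define F where "F d = sin (2 * pi * real (a + 1) * real d / (2 * real (n + 1) + 1)) *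
    sin (2 * pi * real (c + 1) * real d / (2 * real (n + 1) + 1))" for d :: nat
  have "(\<Sum>d = 0..n. s a d * s c d) = (\<Sum>d = 0..n. F (Suc d))"
    by (simp add: F_def s_def add_ac)
  also have "\<dots> = sum F {1..n + 1}"
    using sum.shift_bounds_cl_Suc_ivl[of F 0 n] by simp
  also have "\<dots> = (if a = c then (2 * real n + 3) / 4 else 0)"
    unfolding F_def using assms by (subst sum_sin_orthogonal) auto
  finally have o: "(\<Sum>d = 0..n. s a d * s c d) = (if a = c then (2 * real n + 3) / 4 else 0)" .
  have "(\<Sum>d = 0..n. verlinde_S n $$ (a, d) * verlinde_S n $$ (c, d))
      = (\<Sum>d = 0..n. complex_of_real (4 / (2 * real n + 3) * (s a d * s c d)))"
  proof (intro sum.cong refl)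
    fix d assume "d \<in> {0..n}"
    have "2 / sqrt (2 * real n + 3) * s a d * (2 / sqrt (2 * real n + 3) * s c d)
        = 4 / (sqrt (2 * real n + 3) * sqrt (2 * real n + 3)) * (s a d * s c d)" by simp
    then show "verlinde_S n $$ (a, d) * verlinde_S n $$ (c, d)
        = complex_of_real (4 / (2 * real n + 3) * (s a d * s c d))"
      using assms \<open>d \<in> {0..n}\<close> by (simp add: verlinde_S_index s_def flip: of_real_mult)
  qed
  also have "\<dots> = complex_of_real (4 / (2 * real n + 3) * (\<Sum>d = 0..n. s a d * s c d))"
    by (simp only: of_real_sum sum_distrib_left)
  also have "4 / (2 * real n + 3) * (\<Sum>d = 0..n. s a d * s c d) = (if a = c then 1 else 0)"
    by (simp add: o add_eq_0_iff)
  finally show ?thesis by simp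
qed

lemma verlinde_S_sym:
  assumes "a \<le> n" "d \<le> n"
  shows "verlinde_S n $$ (a, d) = verlinde_S n $$ (d, a)"
proof -
  have "2 * pi * (real a + 1) * (real d + 1) = 2 * pi * (real d + 1) * (real a + 1)" by simp
  then show ?thesis using assms by (simp only: verlinde_S_index)
qed

lemma verlinde_S_involution: "verlinde_S n * verlinde_S n = 1\<^sub>m (Suc n)"
proof (rule eq_matI)
  fix i j assume "i < dim_row (1\<^sub>m (Suc n) :: complex mat)" "j < dim_col (1\<^sub>m (Suc n) :: complex mat)"
  then have i: "i \<le> n" and j: "j \<le> n" by auto
  have dims: "dim_row (verlinde_S n) = n + 1" "dim_col (verlinde_S n) = n + 1"
    by (simp_all add: verlinde_S_def)
  have "(verlinde_S n * verlinde_S n) $$ (i, j)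
      = (\<Sum>d = 0..n. verlinde_S n $$ (i, d) * verlinde_S n $$ (d, j))"
    using i j by (simp add: dims scalar_prod_def atLeastLessThanSuc_atLeastAtMost del: sum.op_ivl_Suc)
  also have "\<dots> = (\<Sum>d = 0..n. verlinde_S n $$ (i, d) * verlinde_S n $$ (j, d))"
    using j by (intro sum.cong refl) (simp add: verlinde_S_sym)
  finally show "(verlinde_S n * verlinde_S n) $$ (i, j) = 1\<^sub>m (Suc n) $$ (i, j)"
    using i j by (simp add: verlinde_S_orthogonal)
qed (simp_all add: verlinde_S_def)

text \<open>The involution property makes S a unit of the matrix ring, so \<open>mat_inverse\<close>
  does not return \<open>None\<close>; the inverse B it returns satisfies B = (S S) B = S (S B) =
  S.\<close>

lemma verlinde_S_inv_eq: "verlinde_S_inv n = verlinde_S n"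
proof -
  let ?S = "verlinde_S n"
  have "mat_inverse ?S \<noteq> None"
  proof
    assume "mat_inverse ?S = None"
    then have "?S \<notin> Units (ring_mat TYPE(complex) (Suc n) ())"
      by (rule mat_inverse(1)[OF verlinde_S_carrier])
    moreover have "?S \<in> Units (ring_mat TYPE(complex) (Suc n) ())"
      unfolding Units_def using verlinde_S_involution
      by (auto simp: ring_mat_simps intro!: bexI[of _ ?S])
    ultimately show False by simp
  qed
  then obtain B where B: "mat_inverse ?S = Some B" by auto
  from mat_inverse(2)[OF verlinde_S_carrier B]
  have BS: "?S * B = 1\<^sub>m (Suc n)" and Bc: "B \<in> carrier_mat (Suc n) (Suc n)" by auto
  have "B = (?S * ?S) * B" using Bc by (simp add: verlinde_S_involution)
  also have "\<dots> = ?S * (?S * B)" by (rule assoc_mult_mat[OF verlinde_S_carrier verlinde_S_carrier Bc])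
  also have "\<dots> = ?S" unfolding BS by (rule right_mult_one_mat[OF verlinde_S_carrier])
  finally show ?thesis by (simp add: verlinde_S_inv_def B)
qed

section \<open>Clebsch-Gordan expansion and reflection of large weights\<close>

text \<open>For p = a + 1, division by sin x squared gives the product rule for the
  \<open>sl\<^sub>2\<close> characters sin ((m + 1) x) / sin x.\<close>

lemma sin_times_sin_eq_sum:
  fixes p x :: real and b :: nat
  shows "sin (p * x) * sin ((real b + 1) * x) = sin x * (\<Sum>i\<le>b. sin ((p - real b + 2 * real i) * x))"
proof -
  \<comment> \<open>Since sin x sin (q x) = (cos ((q - 1) x) - cos ((q + 1) x)) / 2 and q grows by 2
    with each i, neighbouring terms share a cosine and the sum telescopes.\<close>
  define f where "f i = - cos ((p - real b + 2 * real i - 1) * x) / 2" for i :: nat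
  have "sin x * sin ((p - real b + 2 * real i) * x) = f (Suc i) - f i" for i
  proof -
    have "f (Suc i) = - cos ((p - real b + 2 * real i) * x + x) / 2"
      "f i = - cos ((p - real b + 2 * real i) * x - x) / 2"
      by (simp_all add: f_def algebra_simps)
    then have "f (Suc i) - f i = (cos ((p - real b + 2 * real i) * x - x) - cos ((p - real b + 2 * real i) * x + x)) / 2"
      by simp
    then show ?thesis by (simp only: sin_times_sin[symmetric] mult.commute)
  qed
  then have "sin x * (\<Sum>i\<le>b. sin ((p - real b + 2 * real i) * x)) = (\<Sum>i<Suc b. f (Suc i) - f i)"
    by (simp add: sum_distrib_left lessThan_Suc_atMost)
  also have "\<dots> = f (Suc b) - f 0" by (rule sum_lessThan_telescope)
  also have "f (Suc b) = - cos (p * x + (real b + 1) * x) / 2"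
    by (simp add: f_def algebra_simps)
  also have "f 0 = - cos (p * x - (real b + 1) * x) / 2"
    by (simp add: f_def algebra_simps)
  finally show ?thesis by (simp only: sin_times_sin) simp
qed

text \<open>The reflection is m + 1 -> 2 n + 3 - (m + 1) on the weights shifted by one, under which
  the sines in S change sign; \<open>folded_sign\<close> records that sign.\<close>

definition folded_index :: "nat \<Rightarrow> nat \<Rightarrow> nat" where
  "folded_index n m = (if m \<le> n then m else 2 * n + 1 - m)"

definition folded_sign :: "nat \<Rightarrow> nat \<Rightarrow> complex" where
  "folded_sign n m = (if m \<le> n then 1 else - 1)"

lemma folded_index_le: "folded_index n m \<le> n"
  by (auto simp: folded_index_def)

lemma sin_folded:
  assumes "m \<le> 2 * n" "d \<le> n"
  shows "complex_of_real (2 / sqrt (2 * real n + 3) *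
     sin (2 * pi * (real m + 1) * (real d + 1) / (2 * real n + 3)))
     = folded_sign n m * verlinde_S n $$ (folded_index n m, d)"
proof (cases "m \<le> n")
  case True
  then show ?thesis using assms by (simp add: folded_index_def folded_sign_def verlinde_S_index)
next
  case False
  \<comment> \<open>The modulus 2 n + 3 cancels, so the reflected angle is a whole multiple of 2 pi
    minus the original one.\<close>
  have "2 * pi * (real (2 * n + 1 - m) + 1) * (real d + 1) / (2 * real n + 3)
      = 2 * pi * real (d + 1) - 2 * pi * (real m + 1) * (real d + 1) / (2 * real n + 3)"
    using assms by (simp add: of_nat_diff field_simps)
  then have "sin (2 * pi * (real (2 * n + 1 - m) + 1) * (real d + 1) / (2 * real n + 3))
      = - sin (2 * pi * (real m + 1) * (real d + 1) / (2 * real n + 3))"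
    using sin_2npi[of "d + 1"] cos_2npi[of "d + 1"]
    by (simp only: sin_diff) (simp add: mult_ac)
  then show ?thesis
    using False assms by (simp add: folded_index_def folded_sign_def verlinde_S_index)
qed

lemma verlinde_S_fusion:
  assumes "b \<le> a" "a \<le> n" "d \<le> n"
  shows "verlinde_S n $$ (a, d) * verlinde_S n $$ (b, d) / verlinde_S n $$ (0, d)
    = (\<Sum>i\<le>b. folded_sign n (a - b + 2 * i) * verlinde_S n $$ (folded_index n (a - b + 2 * i), d))"
proof -
  define x where "x = 2 * pi * (real d + 1) / (2 * real n + 3)"
  define r where "r = 2 / sqrt (2 * real n + 3)"
  have r: "r > 0" by (simp add: r_def)
  have ang: "2 * pi * t * (real d + 1) / (2 * real n + 3) = t * x" for t
    by (simp add: x_def)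
  have S: "verlinde_S n $$ (m, d) = complex_of_real (r * sin ((real m + 1) * x))" if "m \<le> n" for m
    using that assms by (simp add: verlinde_S_index ang r_def)
  \<comment> \<open>This gives 2 (d + 1) < 2 n + 3, so x < pi and the divisor
    \<open>verlinde_S n $$ (0, d)\<close> is nonzero.\<close>
  have "real d \<le> real n" using assms by simp
  then have "0 < x" "x < pi"
    by (simp_all add: x_def divide_simps)
  then have sx: "sin x > 0" by (rule sin_gt_zero)
  have "verlinde_S n $$ (a, d) * verlinde_S n $$ (b, d) / verlinde_S n $$ (0, d)
      = complex_of_real (r * (sin ((real a + 1) * x) * sin ((real b + 1) * x) / sin x))"
    using assms r by (simp add: S flip: of_real_mult of_real_divide)
  also have "sin ((real a + 1) * x) * sin ((real b + 1) * x) / sin x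
      = (\<Sum>i\<le>b. sin ((real a + 1 - real b + 2 * real i) * x))"
    using sx by (simp only: sin_times_sin_eq_sum) simp
  \<comment> \<open>By b <= a the natural-number subtraction is exact.\<close>
  also have "complex_of_real (r * \<dots>)
      = (\<Sum>i\<le>b. complex_of_real (r * sin ((real (a - b + 2 * i) + 1) * x)))"
    using assms by (simp add: sum_distrib_left of_nat_diff algebra_simps)
  also have "\<dots> = (\<Sum>i\<le>b. folded_sign n (a - b + 2 * i) * verlinde_S n $$ (folded_index n (a - b + 2 * i), d))"
  proof (intro sum.cong refl)
    fix i assume "i \<in> {..b}"
    then have "a - b + 2 * i \<le> 2 * n" using assms by auto
    from sin_folded[OF this assms(3)]
    show "complex_of_real (r * sin ((real (a - b + 2 * i) + 1) * x))
       = folded_sign n (a - b + 2 * i) * verlinde_S n $$ (folded_index n (a - b + 2 * i), d)"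
      by (simp only: ang r_def)
  qed
  finally show ?thesis .
qed

section \<open>Structure constants and operations of the algebra\<close>

text \<open>After the fusion expansion and an exchange of sums, orthogonality of the rows of S keeps
  exactly the terms whose folded index is \<open>c\<close>.\<close>

lemma verlinde_N_eq:
  assumes "b \<le> a" "a \<le> n" "c \<le> n"
  shows "verlinde_N n a b c
    = (\<Sum>i\<le>b. if folded_index n (a - b + 2 * i) = c then folded_sign n (a - b + 2 * i) else 0)"
proof -
  let ?m = "\<lambda>i. a - b + 2 * i"
  have "verlinde_N n a b c
      = (\<Sum>d = 0..n. (verlinde_S n $$ (a, d) * verlinde_S n $$ (b, d) / verlinde_S n $$ (0, d))
           * verlinde_S n $$ (c, d))"
    by (simp add: verlinde_N_def verlinde_S_inv_eq)
  also have "\<dots> = (\<Sum>d = 0..n. \<Sum>i\<le>b. folded_sign n (?m i) *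
      (verlinde_S n $$ (folded_index n (?m i), d) * verlinde_S n $$ (c, d)))"
    using assms by (intro sum.cong refl) (simp add: verlinde_S_fusion sum_distrib_right mult.assoc)
  also have "\<dots> = (\<Sum>i\<le>b. folded_sign n (?m i) *
      (\<Sum>d = 0..n. verlinde_S n $$ (folded_index n (?m i), d) * verlinde_S n $$ (c, d)))"
    by (subst sum.swap) (simp add: sum_distrib_left)
  also have "\<dots> = (\<Sum>i\<le>b. if folded_index n (?m i) = c then folded_sign n (?m i) else 0)"
    using assms by (intro sum.cong refl) (simp add: verlinde_S_orthogonal folded_index_le)
  finally show ?thesis .
qed

lemma verlinde_chi_mult_index:
  assumes "a \<le> n" "b \<le> n" "c \<le> n"
  shows "(verlinde_chi n a \<otimes>\<^bsub>verlinde_algebra n\<^esub> verlinde_chi n b) $ c = verlinde_N n a b c"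
proof -
  have "(verlinde_chi n a \<otimes>\<^bsub>verlinde_algebra n\<^esub> verlinde_chi n b) $ c
      = (\<Sum>a' = 0..n. \<Sum>b' = 0..n.
          if a' = a then (if b' = b then verlinde_N n a' b' c else 0) else 0)"
    using assms
    by (auto simp: verlinde_algebra_def verlinde_chi_def intro!: sum.cong)
  also have "\<dots> = (\<Sum>a' = 0..n. if a' = a then verlinde_N n a' b c else 0)"
    using assms by (intro sum.cong refl) simp
  finally show ?thesis using assms by simp
qed

text \<open>Both sides are the same \<open>finprod\<close>, because the algebra inherits addition
  and zero from \<open>module_vec\<close>. This gives access to coordinatewise evaluation of
  \<open>finsum_vec\<close>.\<close>

lemma verlinde_algebra_finsum:
  "finsum (verlinde_algebra n) f I = finsum_vec TYPE(complex) (n + 1) f I"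
  by (simp add: finsum_def finsum_vec_def finprod_def verlinde_algebra_def module_vec_def monoid_vec_def)

lemma verlinde_algebra_a_inv:
  "\<ominus>\<^bsub>verlinde_algebra n\<^esub> w = inv\<^bsub>monoid_vec TYPE(complex) (n + 1)\<^esub> w"
  by (simp add: a_inv_def m_inv_def verlinde_algebra_def module_vec_def monoid_vec_def)

text \<open>The abstract additive inverse agrees with vector negation by uniqueness of inverses in
  the additive monoid.\<close>

lemma verlinde_algebra_minus:
  assumes "v \<in> carrier_vec (n + 1)" "w \<in> carrier_vec (n + 1)"
  shows "v \<ominus>\<^bsub>verlinde_algebra n\<^esub> w = v - w"
proof -
  interpret V: comm_monoid "monoid_vec TYPE(complex) (n + 1)"
    by (rule comm_monoid_vec)
  have "\<ominus>\<^bsub>verlinde_algebra n\<^esub> w = inv\<^bsub>monoid_vec TYPE(complex) (n + 1)\<^esub> w"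
    by (rule verlinde_algebra_a_inv)
  also have "\<dots> = - w"
    using assms by (intro V.inv_unique'[symmetric]) (auto simp: monoid_vec_simps)
  finally show ?thesis
    using assms by (auto simp: a_minus_def verlinde_algebra_def module_vec_def)
qed

section \<open>The explicit product, compared coordinate by coordinate\<close>

theorem proposition4p2:
  fixes n a b :: nat
  assumes "n \<ge> 1" and "b \<le> a" and "a \<le> n"
  shows "verlinde_chi n a \<otimes>\<^bsub>verlinde_algebra n\<^esub> verlinde_chi n b =
    (\<Oplus>\<^bsub>verlinde_algebra n\<^esub>
        i \<in> {i :: int. 0 \<le> i \<and> real_of_int i \<le> min (real b) ((real n + real b - real a) / 2)}.
        verlinde_chi n (nat (int a - int b + 2 * i)))
    \<ominus>\<^bsub>verlinde_algebra n\<^esub>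
    (\<Oplus>\<^bsub>verlinde_algebra n\<^esub>
        i \<in> {i :: int. (real n + real b - real a) / 2 < real_of_int i \<and> i \<le> int b}.
        verlinde_chi n (nat (2 * int n + 1 + int b - 2 * i - int a)))"
    (is "?L = finsum _ ?f ?A \<ominus>\<^bsub>_\<^esub> finsum _ ?g ?B")
proof -
  let ?F = "finsum_vec TYPE(complex) (n + 1)"
  let ?m = "\<lambda>i. a - b + 2 * i"
  \<comment> \<open>\<open>I\<close> collects the terms that need no reflection, \<open>J\<close>
    the reflected ones: i <= (n + b - a) / 2 is equivalent to a - b + 2 i <= n.\<close>
  define I where "I = {i. i \<le> b \<and> ?m i \<le> n}"
  define J where "J = {i. i \<le> b \<and> \<not> ?m i \<le> n}"
  have A: "?A = int ` I"
  proof (intro equalityI subsetI)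
    fix i assume "i \<in> ?A"
    then have i: "0 \<le> i" "real_of_int i \<le> real b" "2 * real_of_int i \<le> real n + real b - real a"
      by auto
    then have "i \<le> int b" "2 * i \<le> int n + int b - int a" by linarith+
    then have "nat i \<in> I" using i(1) assms by (auto simp: I_def)
    then show "i \<in> int ` I" using i(1) by (metis image_eqI int_nat_eq)
  next
    fix i assume "i \<in> int ` I"
    then show "i \<in> ?A" using assms by (auto simp: I_def)
  qed
  have B: "?B = int ` J"
  proof (intro equalityI subsetI)
    fix i assume "i \<in> ?B"
    then have i: "i \<le> int b" "2 * real_of_int i > real n + real b - real a"
      by auto
    then have h: "2 * i > int n + int b - int a" by linarith
    \<comment> \<open>The set itself gives no lower bound 0; it follows from 2 i > n + b - a >= 0,
      as a <= n.\<close>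
    then have "0 \<le> i" using assms by linarith
    then have "nat i \<in> J" using i(1) h assms by (auto simp: J_def)
    then show "i \<in> int ` J" using \<open>0 \<le> i\<close> by (metis image_eqI int_nat_eq)
  next
    fix i assume "i \<in> int ` J"
    then show "i \<in> ?B" using assms by (auto simp: J_def)
  qed
  have fin: "finite I" "finite J" by (simp_all add: I_def J_def)
  then have finA: "finite ?A" and finB: "finite ?B" unfolding A B by simp_all
  have f: "?f \<in> ?A \<rightarrow> carrier_vec (n + 1)" and g: "?g \<in> ?B \<rightarrow> carrier_vec (n + 1)"
    by (simp_all add: verlinde_chi_def)
  have sf: "?F ?f ?A \<in> carrier_vec (n + 1)"
    by (rule finsum_vec_closed[OF f])
  have sg: "?F ?g ?B \<in> carrier_vec (n + 1)"
    by (rule finsum_vec_closed[OF g])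
  have "?L = ?F ?f ?A - ?F ?g ?B"
  proof (rule eq_vecI)
    show "dim_vec ?L = dim_vec (?F ?f ?A - ?F ?g ?B)"
      using sg by (simp add: verlinde_algebra_def)
    fix c assume "c < dim_vec (?F ?f ?A - ?F ?g ?B)"
    then have c: "c \<le> n" using sg by simp
    have cf: "?F ?f ?A $ c = (\<Sum>i\<in>I. if ?m i = c then 1 else 0)"
    proof -
      have "?F ?f ?A $ c = (\<Sum>i\<in>?A. ?f i $ c)"
        using c by (intro index_finsum_vec[OF finA _ f]) simp
      also have "\<dots> = (\<Sum>i\<in>I. if ?m i = c then 1 else 0)"
        unfolding A using c assms
        by (subst sum.reindex) (auto simp: verlinde_chi_def nat_diff_distrib nat_add_distrib unit_vec_def I_def intro!: sum.cong)
      finally show ?thesis .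
    qed
    \<comment> \<open>The weight 2 n + 1 + b - 2 i - a is the reflection of a - b + 2 i, and a - b +
      2 i <= a + b <= 2 n keeps the subtraction exact.\<close>
    have cg: "?F ?g ?B $ c = (\<Sum>i\<in>J. if 2 * n + 1 - ?m i = c then 1 else 0)"
    proof -
      have "?F ?g ?B $ c = (\<Sum>i\<in>?B. ?g i $ c)"
        using c by (intro index_finsum_vec[OF finB _ g]) simp
      also have "\<dots> = (\<Sum>i\<in>J. if 2 * n + 1 - ?m i = c then 1 else 0)"
        unfolding B using c assms
        by (subst sum.reindex) (auto simp: verlinde_chi_def unit_vec_def J_def intro!: sum.cong)
      finally show ?thesis .
    qed
    have "{..b} = I \<union> J" by (auto simp: I_def J_def)
    moreover have "I \<inter> J = {}" by (auto simp: I_def J_def)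
    ultimately have "?L $ c
        = (\<Sum>i\<in>I. if folded_index n (?m i) = c then folded_sign n (?m i) else 0)
        + (\<Sum>i\<in>J. if folded_index n (?m i) = c then folded_sign n (?m i) else 0)"
      using assms c fin by (simp add: verlinde_chi_mult_index verlinde_N_eq sum.union_disjoint)
    also have "(\<Sum>i\<in>I. if folded_index n (?m i) = c then folded_sign n (?m i) else 0)
        = ?F ?f ?A $ c"
      unfolding cf by (intro sum.cong refl) (auto simp: I_def folded_index_def folded_sign_def)
    \<comment> \<open>On \<open>J\<close> every folded sign is -1, which produces the subtracted
      sum.\<close>
    also have "(\<Sum>i\<in>J. if folded_index n (?m i) = c then folded_sign n (?m i) else 0)
        = - ?F ?g ?B $ c"
      unfolding cg sum_negf[symmetric]
      by (intro sum.cong refl) (auto simp: J_def folded_index_def folded_sign_def)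
    finally show "?L $ c = (?F ?f ?A - ?F ?g ?B) $ c"
      using c sg by simp
  qed
  then show ?thesis
    using sf sg by (simp only: verlinde_algebra_finsum verlinde_algebra_minus)
qed

end
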